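(* Let $f:\mathbb{R}^n\to\mathbb{R}$ be convex and $L$-smooth with nonempty set of minimizers $X^*$, let $\varepsilon>0$, and let $x_0\in\mathbb{R}^n$ with $\|\nabla f(x_0)\|>\varepsilon$. Then the guess-and-check AR algorithm (described in the context, and requiring only $\varepsilon$ and $x_0$ as input) computes a solution $\hat x$ such that $\|\nabla f(\hat x)\|\le\varepsilon$ with at most $$4\left\lceil\log_4\frac{4\sqrt2\,L\operatorname{dist}(x_0,X^* )}{\varepsilon}\right\rceil+4\sqrt5\,C_1\sqrt{\frac{L\operatorname{dist}(x_0,X^* )}{\varepsilon}}$$ gradient evaluations of $\nabla f$, where $C_1:=\sqrt2\,(3+16\sqrt{2c_{\mathcal A}})$.
   Context: $\|\cdot\|$ is the Euclidean norm; $\operatorname{dist}(x_0,X^* )=\min_{x^*\in X^*}\|x_0-x^*\|$. $L$-smooth means differentiable with $\|\nabla f(x)-\nabla f(y)\|\le L\|x-y\|$ for all $x,y$. Backtracking$(g,\sigma,x,M_0)$: for $j=0,1,\dots$ set $x^{++}=x-\frac{1}{2(M_j+\sigma)}\nabla g(x)$; if $g(x^{++})-g(x)-\langle\nabla g(x),x^{++}-x\rangle\le\frac{M_j+\sigma}{2}\|x^{++}-x\|^2$, terminate and return $M=M_j$; otherwise set $M_{j+1}=2M_j$. (Only one gradient, at $x$, is used.) AR method $(\hat x,M)=\mathrm{AR}(f,x_0,\sigma_1,M_0)$: set $\overline{x}_0=x_0$, $\sigma_0=0$. For $s=1,2,\dots$: if $s>1$ set $\sigma_s=4\sigma_{s-1}$;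 set $\overline{x}_s=(1-\gamma_s)\overline{x}_{s-1}+\gamma_sx_{s-1}$ with $\gamma_s=1-\sigma_{s-1}/\sigma_s$; compute an approximate solution $x_s=\mathcal{A}(f,\sigma_s,\overline{x}_s,x_{s-1})$ of $x_s^*:=\operatorname{argmin}_{x\in\mathbb{R}^n}\{f_s(x):=f(x)+\frac{\sigma_s}{2}\|x-\overline{x}_s\|^2\}$; set $M_s=\text{Backtracking}(f_s,\sigma_s,x_s,M_{s-1}/2)$; if $\sigma_s\ge M_s$, terminate with $\hat x=x_s$, $M=M_s$. Assumption on the subroutine $\mathcal{A}$: after its $k$-th gradient evaluation of $\nabla f$ it has computed an approximate solution $x_s^k$ and an estimate $L_s^k\le c_{\mathcal A}L$ with $f_s(x_s^k)-f_s(x_s^* )\le\frac{L_s^k}{k^2}\|x_{s-1}-x_s^*\|^2$, where $c_{\mathcal A}$ is a universal constant depending on $\mathcal{A}$; it terminates whenever $k\ge8\sqrt{2L_s^k/\sigma_s}$ and outputs $x_s=x_s^k$. Guess-and-check AR algorithm. Input: target accuracy $\varepsilon>0$ and $x_0$. Select any $z_0\ne x_0$ with $\nabla f(x_0)\ne\nabla f(z_0)$. Set $\tilde M_0=\|\nabla f(x_0)-\nabla f(z_0)\|/\|x_0-z_0\|$, $M_0=\text{Backtracking}(f,0,x_0,\tilde M_0)$, $D_0=\|\nabla f(x_0)\|/(2\sqrt2M_0)$. For $t=1,2,\dots$: set $D_t=4D_{t-1}$ and $(\hat x,M_t)=\mathrm{AR}(f,x_0,\varepsilon/(5D_t),M_{t-1})$;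 if $\|\nabla f(\hat x)\|\le\varepsilon$, terminate with $\hat x$. *)

theory Defs
  imports "HOL-Analysis.Analysis" "HOL-Library.Monad_Syntax"
begin

section \<open>Smooth convex minimization\<close>

definition grad :: "('a::real_inner \<Rightarrow> real) \<Rightarrow> 'a \<Rightarrow> 'a" where
  "grad f x = (THE d. GDERIV f x :> d)"

definition smooth :: "real \<Rightarrow> ('a::real_inner \<Rightarrow> real) \<Rightarrow> bool" where
  "smooth L f \<longleftrightarrow>
     (\<forall>x. f differentiable (at x)) \<and> (\<forall>x y. norm (grad f x - grad f y) \<le> L * norm (x - y))"

definition minimizers :: "('a \<Rightarrow> real) \<Rightarrow> 'a set" where
  "minimizers f = {x. is_arg_min f (\<lambda>_. True) x}"

definition prox_obj :: "('a::real_inner \<Rightarrow> real) \<Rightarrow> real \<Rightarrow> 'a \<Rightarrow> 'a \<Rightarrow> real" where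
  "prox_obj f \<sigma> xbar = (\<lambda>x. f x + \<sigma> / 2 * (norm (x - xbar))\<^sup>2)"


section \<open>Computations that count gradient evaluations\<close>

text \<open>
  \<open>None\<close> is a computation that runs forever. \<open>Some (r, n)\<close> is one that returns \<open>r\<close> after
  \<open>n\<close> gradient evaluations. Values of the objective function are not counted.
\<close>

type_synonym 'r counted = "('r \<times> nat) option"

definition return :: "'r \<Rightarrow> 'r counted" where
  "return r = Some (r, 0)"

definition bind_counted :: "'r counted \<Rightarrow> ('r \<Rightarrow> 's counted) \<Rightarrow> 's counted" where
  "bind_counted c k =
     Option.bind c (\<lambda>(r, m). Option.bind (k r) (\<lambda>(s, n). Some (s, m + n)))"

adhoc_overloading bind \<rightleftharpoons> bind_counted

text \<open>
  The objective passed to \<open>eval_grad\<close> below is either \<open>f\<close> or \<open>prox_obj f \<sigma> xbar\<close>. In the second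
  case the gradient is \<open>grad f x + \<sigma> *\<^sub>R (x - xbar)\<close>, which also takes one evaluation of
  \<open>grad f\<close>. Results bound in a \<open>do\<close> block can be reused without further cost.
\<close>

definition eval_grad :: "('a::real_inner \<Rightarrow> real) \<Rightarrow> 'a \<Rightarrow> 'a counted" where
  "eval_grad g x = Some (grad g x, 1)"

lemma bind_counted_mono [partial_function_mono]:
  assumes "mono_option B" and "\<And>r. mono_option (\<lambda>F. C r F)"
  shows "mono_option (\<lambda>F. bind_counted (B F) (\<lambda>r. C r F))"
  unfolding bind_counted_def case_prod_unfold
  by (intro bind_mono assms option.const_mono)


section \<open>Backtracking\<close>

definition backtracking_test :: "('a::real_inner \<Rightarrow> real) \<Rightarrow> real \<Rightarrow> 'a \<Rightarrow> 'a \<Rightarrow> real \<Rightarrow> bool" where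
  "backtracking_test g \<sigma> x d M \<longleftrightarrow>
     (let x' = x - (1 / (2 * (M + \<sigma>))) *\<^sub>R d
      in g x' - g x - d \<bullet> (x' - x) \<le> (M + \<sigma>) / 2 * (norm (x' - x))\<^sup>2)"

partial_function (option) backtracking_loop ::
    "('a::real_inner \<Rightarrow> real) \<Rightarrow> real \<Rightarrow> 'a \<Rightarrow> 'a \<Rightarrow> real \<Rightarrow> real counted" where
  "backtracking_loop g \<sigma> x d M =
     (if backtracking_test g \<sigma> x d M then return M
      else backtracking_loop g \<sigma> x d (2 * M))"

definition backtracking ::
    "('a::real_inner \<Rightarrow> real) \<Rightarrow> real \<Rightarrow> 'a \<Rightarrow> real \<Rightarrow> real counted" where
  "backtracking g \<sigma> x M\<^sub>0 = do {
     d \<leftarrow> eval_grad g x;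
     backtracking_loop g \<sigma> x d M\<^sub>0
   }"


section \<open>The subroutine for the proximal subproblems\<close>

text \<open>
  For \<open>A :: 'a subroutine\<close>, the value \<open>A f \<sigma> xbar xprev k\<close> is the pair of the approximate
  solution of the subproblem of minimizing \<open>prox_obj f \<sigma> xbar\<close> and the estimate of the
  smoothness constant that the subroutine, started at \<open>xprev\<close>, holds after its \<open>k\<close>-th
  gradient evaluation. The accuracy condition is stated for one objective with smoothness
  constant \<open>L\<close>. A subroutine with a universal constant \<open>c\<close> satisfies it for all of them.
\<close>

type_synonym 'a subroutine = "('a \<Rightarrow> real) \<Rightarrow> real \<Rightarrow> 'a \<Rightarrow> 'a \<Rightarrow> nat \<Rightarrow> 'a \<times> real"

definition subroutine_accuracy ::
    "'a::real_inner subroutine \<Rightarrow> real \<Rightarrow> ('a \<Rightarrow> real) \<Rightarrow> real \<Rightarrow> bool" where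
  "subroutine_accuracy A c f L \<longleftrightarrow>
     (\<forall>\<sigma> xbar xprev. \<forall>k\<ge>1. \<sigma> > 0 \<longrightarrow>
       (let (x, l) = A f \<sigma> xbar xprev k;
            fs = prox_obj f \<sigma> xbar;
            xopt = arg_min fs (\<lambda>_. True)
        in l \<le> c * L \<and> fs x - fs xopt \<le> l / (real k)\<^sup>2 * (norm (xprev - xopt))\<^sup>2))"

partial_function (option) run_subroutine_from ::
    "nat \<Rightarrow> 'a subroutine \<Rightarrow> ('a \<Rightarrow> real) \<Rightarrow> real \<Rightarrow> 'a \<Rightarrow> 'a \<Rightarrow> 'a counted" where
  "run_subroutine_from k A f \<sigma> xbar xprev =
     (let (x, l) = A f \<sigma> xbar xprev k
      in if real k \<ge> 8 * sqrt (2 * l / \<sigma>) then Some (x, k)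
         else run_subroutine_from (k + 1) A f \<sigma> xbar xprev)"

definition run_subroutine ::
    "'a subroutine \<Rightarrow> ('a \<Rightarrow> real) \<Rightarrow> real \<Rightarrow> 'a \<Rightarrow> 'a \<Rightarrow> 'a counted" where
  "run_subroutine = run_subroutine_from 1"


section \<open>The accumulative regularization (AR) method\<close>

text \<open>
  The arguments \<open>\<sigma>prev\<close>, \<open>xbarprev\<close>, \<open>xprev\<close>, \<open>Mprev\<close> carry the values of index \<open>s - 1\<close>, and
  \<open>\<sigma>\<close> is the value of index \<open>s\<close>.
\<close>

partial_function (option) AR_loop ::
    "'a::real_inner subroutine \<Rightarrow> ('a \<Rightarrow> real) \<Rightarrow> real \<Rightarrow> real \<Rightarrow> 'a \<Rightarrow> 'a \<Rightarrow> real \<Rightarrow>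
     ('a \<times> real) counted" where
  "AR_loop A f \<sigma>prev \<sigma> xbarprev xprev Mprev =
     (let \<gamma> = 1 - \<sigma>prev / \<sigma>;
          xbar = (1 - \<gamma>) *\<^sub>R xbarprev + \<gamma> *\<^sub>R xprev
      in do {
        x \<leftarrow> run_subroutine A f \<sigma> xbar xprev;
        M \<leftarrow> backtracking (prox_obj f \<sigma> xbar) \<sigma> x (Mprev / 2);
        if \<sigma> \<ge> M then return (x, M) else AR_loop A f \<sigma> (4 * \<sigma>) xbar x M
      })"

definition AR ::
    "'a::real_inner subroutine \<Rightarrow> ('a \<Rightarrow> real) \<Rightarrow> 'a \<Rightarrow> real \<Rightarrow> real \<Rightarrow> ('a \<times> real) counted" where
  "AR A f x\<^sub>0 \<sigma>\<^sub>1 M\<^sub>0 = AR_loop A f 0 \<sigma>\<^sub>1 x\<^sub>0 x\<^sub>0 M\<^sub>0"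


section \<open>The guess-and-check AR algorithm\<close>

partial_function (option) guess_and_check_loop ::
    "'a::real_inner subroutine \<Rightarrow> ('a \<Rightarrow> real) \<Rightarrow> real \<Rightarrow> 'a \<Rightarrow> real \<Rightarrow> real \<Rightarrow> 'a counted" where
  "guess_and_check_loop A f \<epsilon> x\<^sub>0 Dprev Mprev =
     (let D = 4 * Dprev
      in do {
        (xhat, M) \<leftarrow> AR A f x\<^sub>0 (\<epsilon> / (5 * D)) Mprev;
        d \<leftarrow> eval_grad f xhat;
        if norm d \<le> \<epsilon> then return xhat else guess_and_check_loop A f \<epsilon> x\<^sub>0 D M
      })"

definition admissible_start :: "('a::real_inner \<Rightarrow> real) \<Rightarrow> 'a \<Rightarrow> 'a \<Rightarrow> bool" where
  "admissible_start f x\<^sub>0 z\<^sub>0 \<longleftrightarrow> z\<^sub>0 \<noteq> x\<^sub>0 \<and> grad f x\<^sub>0 \<noteq> grad f z\<^sub>0"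

definition guess_and_check ::
    "'a::real_inner subroutine \<Rightarrow> ('a \<Rightarrow> real) \<Rightarrow> real \<Rightarrow> 'a \<Rightarrow> 'a \<Rightarrow> 'a counted" where
  "guess_and_check A f \<epsilon> x\<^sub>0 z\<^sub>0 = do {
     dx \<leftarrow> eval_grad f x\<^sub>0;
     dz \<leftarrow> eval_grad f z\<^sub>0;
     M\<^sub>0 \<leftarrow> backtracking f 0 x\<^sub>0 (norm (dx - dz) / norm (x\<^sub>0 - z\<^sub>0));
     guess_and_check_loop A f \<epsilon> x\<^sub>0 (norm dx / (2 * sqrt 2 * M\<^sub>0)) M\<^sub>0
   }"

end

theory Submission
  imports Defs
begin

text \<open>
  Let \<open>d\<close> be the distance from \<open>x\<^sub>0\<close> to the minimizers. Three facts carry the proof.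

  A single call with first weight \<open>\<sigma>\<^sub>1\<close> returns a point whose gradient norm is at most
  \<open>9/4 \<sigma>\<^sub>1 d\<close> (\<open>AR_correct\<close>). Raising the weight adds a regularization term centred at the last
  iterate, which can only pull the minimizer of the subproblem towards that iterate
  (\<open>accumulated_minimizer_closer\<close>), and the subroutine, by strong convexity, then gains a factor 8 on
  this distance. The weight grows only by 4 per pass, so the forces exerted by the successive
  regularization terms form a geometric series of ratio 1/2. The gradient of the last subproblem
  itself is controlled by the backtracking test (\<open>backtracking_test_gradient_bound\<close>), which is why the
  method may stop as soon as \<open>\<sigma> \<ge> M\<close>.

  Backtracking needs one gradient and, started at most at \<open>2 L\<close>, never returns more than \<open>2 L\<close>,
  because the test holds for every \<open>M \<ge> L\<close>. Hence a call makes a second or later pass only if the weight of the previous pass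
  was below \<open>2 L\<close>. Both the number of passes and the work of the subroutine are therefore, up to an
  additive constant, \<open>O(\<surd>(L / \<sigma>\<^sub>1))\<close>, with constants tracked by \<open>AR_loop_correct\<close>.

  With \<open>\<sigma>\<^sub>1 = \<epsilon> / (5 D)\<close> a guess \<open>D \<ge> d\<close> is accepted, since \<open>9/4 \<le> 5\<close>. The guesses grow by 4 and
  the square-root terms of their costs by 2, so these terms sum to less than twice the last one,
  whose guess is below \<open>4 d\<close> (\<open>guess_and_check_loop_correct\<close>). The test passed at \<open>x\<^sub>0\<close> gives
  \<open>D\<^sub>0 < d\<close>, which keeps the last guess below \<open>4 d\<close> even if it is the first one, \<open>4 D\<^sub>0\<close>, and
  \<open>M\<^sub>0 \<le> 2 L\<close> gives \<open>D\<^sub>0 > \<epsilon> / (4 \<surd>2 L)\<close>, which bounds the number of guesses by the logarithm. Each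
  guess costs three evaluations besides the square-root terms, and the three initial evaluations
  fit into the slack of the constant \<open>C\<^sub>1\<close>, because \<open>L d > \<epsilon>\<close>.
\<close>


section \<open>Gradients and minimizers\<close>

lemma mem_minimizers_iff:
  fixes g :: "'a \<Rightarrow> real"
  shows "p \<in> minimizers g \<longleftrightarrow> (\<forall>y. g p \<le> g y)"
  by (simp add: minimizers_def is_arg_min_linorder)

lemma grad_eqI: "GDERIV f x :> d \<Longrightarrow> grad f x = d"
proof -
  assume d: "GDERIV f x :> d"
  have "d' = d" if "GDERIV f x :> d'" for d'
  proof -
    have "(\<lambda>h. h \<bullet> d') = (\<lambda>h. h \<bullet> d)"
      using d that unfolding gderiv_def by (rule has_derivative_unique[rotated])
    then show ?thesis
      by (metis vector_eq_ldot)
  qed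
  with d show ?thesis
    unfolding grad_def by (intro the_equality)
qed

lemma GDERIV_grad:
  fixes f :: "'a::euclidean_space \<Rightarrow> real"
  assumes "f differentiable (at x)"
  shows "GDERIV f x :> grad f x"
proof -
  obtain f' where f': "(f has_derivative f') (at x)"
    using assms by (auto simp: differentiable_def)
  \<comment> \<open>The Riesz representative of the derivative.\<close>
  have "f' h = h \<bullet> adjoint f' 1" for h
    using adjoint_works[OF has_derivative_linear[OF f'], of h 1] by simp
  then have "f' = (\<lambda>h. h \<bullet> adjoint f' 1)"
    by blast
  with f' have "GDERIV f x :> adjoint f' 1"
    unfolding gderiv_def by metis
  then show ?thesis
    using grad_eqI by metis
qed

lemma gradient_zero_at_minimizer:
  assumes "p \<in> minimizers g" and "GDERIV g p :> d"
  shows "d = 0"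
proof -
  have "(\<lambda>h. h \<bullet> d) = (\<lambda>h. 0)"
    using assms(2) unfolding gderiv_def
    by (rule has_derivative_local_min) (use assms(1) in \<open>simp add: mem_minimizers_iff\<close>)
  then have "d \<bullet> d = 0"
    by metis
  then show ?thesis by simp
qed

lemma prox_obj_0 [simp]: "prox_obj f 0 xbar = f"
  by (simp add: prox_obj_def fun_eq_iff)

lemma GDERIV_prox_obj:
  assumes "GDERIV f x :> d"
  shows "GDERIV (prox_obj f \<sigma> xbar) x :> d + \<sigma> *\<^sub>R (x - xbar)"
proof -
  have "(prox_obj f \<sigma> xbar has_derivative
      (\<lambda>h. h \<bullet> d + \<sigma> / 2 * ((x - xbar) \<bullet> h + h \<bullet> (x - xbar)))) (at x)"
    using assms unfolding prox_obj_def gderiv_def power2_norm_eq_inner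
    by (auto intro!: derivative_eq_intros)
  then show ?thesis
    unfolding gderiv_def by (simp add: inner_add_right inner_commute)
qed

lemma half_scaled_sqdist_diff:
  fixes y z xbar :: "'a::real_inner"
  shows "\<sigma> / 2 * (norm (y - xbar))\<^sup>2 - \<sigma> / 2 * (norm (z - xbar))\<^sup>2
    = \<sigma> / 2 * (y \<bullet> y - z \<bullet> z) - (y - z) \<bullet> (\<sigma> *\<^sub>R xbar)"
  by (simp add: power2_norm_eq_inner inner_diff_left inner_diff_right inner_commute algebra_simps
      add_divide_distrib diff_divide_distrib)

lemma half_scaled_sqdist_expand:
  fixes y x xbar :: "'a::real_inner"
  shows "\<sigma> / 2 * (norm (y - xbar))\<^sup>2
    = \<sigma> / 2 * (norm (x - xbar))\<^sup>2 + \<sigma> * ((x - xbar) \<bullet> (y - x)) + \<sigma> / 2 * (norm (y - x))\<^sup>2"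
proof -
  have "(norm (y - xbar))\<^sup>2 = (norm ((x - xbar) + (y - x)))\<^sup>2"
    by simp
  also have "\<dots> = (norm (x - xbar))\<^sup>2 + 2 * ((x - xbar) \<bullet> (y - x)) + (norm (y - x))\<^sup>2"
    unfolding power2_norm_eq_inner inner_add_left inner_add_right by (simp add: inner_commute)
  finally show ?thesis
    by (simp add: distrib_left)
qed

text \<open>
  Moving the proximal centre to a weighted mean of the old centre and the last iterate, while
  raising the weight, adds a regularization term centred at that iterate: up to a constant, each
  objective of the accumulative regularization method is the previous one plus such a term.
\<close>

lemma prox_obj_accumulate:
  fixes y z :: "'a::real_inner"
  assumes "\<sigma> *\<^sub>R xbar = \<sigma>' *\<^sub>R xbar' + (\<sigma> - \<sigma>') *\<^sub>R x'"
  shows "prox_obj f \<sigma> xbar y - prox_obj f \<sigma> xbar z = prox_obj f \<sigma>' xbar' y - prox_obj f \<sigma>' xbar' z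
    + (\<sigma> - \<sigma>') / 2 * ((norm (y - x'))\<^sup>2 - (norm (z - x'))\<^sup>2)"
proof -
  have "(\<sigma> - \<sigma>') / 2 * ((norm (y - x'))\<^sup>2 - (norm (z - x'))\<^sup>2)
      = (\<sigma> - \<sigma>') / 2 * (y \<bullet> y - z \<bullet> z) - (y - z) \<bullet> ((\<sigma> - \<sigma>') *\<^sub>R x')"
    by (simp only: right_diff_distrib[of _ "(norm _)\<^sup>2"] half_scaled_sqdist_diff)
  moreover have "(y - z) \<bullet> (\<sigma> *\<^sub>R xbar)
      = (y - z) \<bullet> (\<sigma>' *\<^sub>R xbar') + (y - z) \<bullet> ((\<sigma> - \<sigma>') *\<^sub>R x')"
    by (simp only: assms inner_add_right)
  ultimately show ?thesis
    using half_scaled_sqdist_diff[of \<sigma> y xbar z] half_scaled_sqdist_diff[of \<sigma>' y xbar' z]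
    by (simp add: prox_obj_def field_simps)
qed

text \<open>
  Adding a multiple of the squared distance to \<open>x'\<close> can only pull the minimizer towards \<open>x'\<close>.
\<close>

lemma accumulated_minimizer_closer:
  fixes x' :: "'a::real_inner"
  assumes "\<sigma> *\<^sub>R xbar = \<sigma>' *\<^sub>R xbar' + (\<sigma> - \<sigma>') *\<^sub>R x'" and "\<sigma>' < \<sigma>"
    and "p' \<in> minimizers (prox_obj f \<sigma>' xbar')" and "p \<in> minimizers (prox_obj f \<sigma> xbar)"
  shows "norm (x' - p) \<le> norm (x' - p')"
proof -
  have "prox_obj f \<sigma> xbar p - prox_obj f \<sigma> xbar p' \<le> 0"
    "prox_obj f \<sigma>' xbar' p - prox_obj f \<sigma>' xbar' p' \<ge> 0"
    using assms(3,4) by (simp_all add: mem_minimizers_iff)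
  with prox_obj_accumulate[OF assms(1), of f p p']
  have "(\<sigma> - \<sigma>') / 2 * ((norm (p - x'))\<^sup>2 - (norm (p' - x'))\<^sup>2) \<le> 0"
    by linarith
  then have "(norm (p - x'))\<^sup>2 \<le> (norm (p' - x'))\<^sup>2"
    using assms(2) by (auto simp: mult_le_0_iff)
  then show ?thesis
    by (simp add: norm_minus_commute power2_le_iff_abs_le)
qed


section \<open>Smooth convex functions\<close>

locale smooth_convex =
  fixes f :: "'a::euclidean_space \<Rightarrow> real" and L :: real
  assumes convex: "convex_on UNIV f" and smooth: "smooth L f"
begin

lemma GDERIV_f: "GDERIV f x :> grad f x"
  using smooth by (simp add: smooth_def GDERIV_grad)

lemma grad_lipschitz: "norm (grad f x - grad f y) \<le> L * norm (x - y)"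
  using smooth by (simp add: smooth_def)

lemma grad_prox_obj: "grad (prox_obj f \<sigma> xbar) x = grad f x + \<sigma> *\<^sub>R (x - xbar)"
  by (rule grad_eqI[OF GDERIV_prox_obj[OF GDERIV_f]])

lemma continuous_on_f: "continuous_on S f"
  using GDERIV_f unfolding gderiv_def
  by (meson continuous_at_imp_continuous_on has_derivative_continuous)

lemma DERIV_along_line: "DERIV (\<lambda>t. f (x + t *\<^sub>R v)) t :> grad f (x + t *\<^sub>R v) \<bullet> v"
proof -
  have "((\<lambda>t. x + t *\<^sub>R v) has_derivative (\<lambda>h. h *\<^sub>R v)) (at t)"
    by (auto intro!: derivative_eq_intros)
  moreover have "(f has_derivative (\<lambda>h. h \<bullet> grad f (x + t *\<^sub>R v))) (at (x + t *\<^sub>R v))"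
    using GDERIV_f by (simp add: gderiv_def)
  ultimately have "((\<lambda>t. f (x + t *\<^sub>R v)) has_derivative (\<lambda>h. (h *\<^sub>R v) \<bullet> grad f (x + t *\<^sub>R v))) (at t)"
    by (rule has_derivative_compose)
  then show ?thesis
    by (simp add: has_field_derivative_def inner_commute mult_commute_abs)
qed

lemma above_tangent: "f x + grad f x \<bullet> (y - x) \<le> f y"
proof -
  let ?\<phi> = "\<lambda>t. f (x + t *\<^sub>R (y - x))"
  have "convex_on UNIV ?\<phi>"
  proof (rule convex_onI)
    fix t a b :: real
    assume t: "0 < t" "t < 1"
    have "x + ((1 - t) *\<^sub>R a + t *\<^sub>R b) *\<^sub>R (y - x)
        = (1 - t) *\<^sub>R (x + a *\<^sub>R (y - x)) + t *\<^sub>R (x + b *\<^sub>R (y - x))"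
      by (simp add: algebra_simps)
    then show "?\<phi> ((1 - t) *\<^sub>R a + t *\<^sub>R b) \<le> (1 - t) * ?\<phi> a + t * ?\<phi> b"
      using t by (simp only:) (intro convex_onD[OF convex], auto)
  qed simp
  then have "?\<phi> 1 - ?\<phi> 0 \<ge> grad f x \<bullet> (y - x) * (1 - 0)"
    by (rule convex_on_imp_above_tangent)
      (use DERIV_along_line[of x "y - x" 0] in \<open>simp_all\<close>)
  then show ?thesis by simp
qed

text \<open>
  Along the segment from \<open>x\<close> to \<open>y\<close> the slope of \<open>f\<close> exceeds its initial value by at most
  \<open>L t \<parallel>y - x\<parallel>\<^sup>2\<close> at time \<open>t\<close>, and this bound integrates to the quadratic term.
\<close>

lemma descent: "f y \<le> f x + grad f x \<bullet> (y - x) + L / 2 * (norm (y - x))\<^sup>2"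
proof -
  let ?v = "y - x"
  let ?\<psi> = "\<lambda>t. f (x + t *\<^sub>R ?v) - t * (grad f x \<bullet> ?v) - L / 2 * (norm ?v)\<^sup>2 * t\<^sup>2"
  have "?\<psi> 1 \<le> ?\<psi> 0"
  proof (rule DERIV_nonpos_imp_nonincreasing[where f = ?\<psi>])
    fix t :: real assume t: "0 \<le> t" "t \<le> 1"
    have "DERIV ?\<psi> t :> grad f (x + t *\<^sub>R ?v) \<bullet> ?v - grad f x \<bullet> ?v - L * (norm ?v)\<^sup>2 * t"
      by (auto intro!: derivative_eq_intros DERIV_along_line)
    moreover have "grad f (x + t *\<^sub>R ?v) \<bullet> ?v - grad f x \<bullet> ?v \<le> L * (norm ?v)\<^sup>2 * t"
    proof -
      have "grad f (x + t *\<^sub>R ?v) \<bullet> ?v - grad f x \<bullet> ?v = (grad f (x + t *\<^sub>R ?v) - grad f x) \<bullet> ?v"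
        by (simp add: inner_diff_left)
      also have "\<dots> \<le> norm (grad f (x + t *\<^sub>R ?v) - grad f x) * norm ?v"
        by (rule norm_cauchy_schwarz)
      also have "\<dots> \<le> (L * norm (x + t *\<^sub>R ?v - x)) * norm ?v"
        by (intro mult_right_mono grad_lipschitz) simp
      also have "\<dots> = L * (norm ?v)\<^sup>2 * t"
        using t by (simp add: power2_eq_square)
      finally show ?thesis .
    qed
    ultimately show "\<exists>d. DERIV ?\<psi> t :> d \<and> d \<le> 0"
      by (intro exI[of _ "grad f (x + t *\<^sub>R ?v) \<bullet> ?v - grad f x \<bullet> ?v - L * (norm ?v)\<^sup>2 * t"])
        simp
  qed simp
  then show ?thesis by simp
qed

lemma prox_obj_descent:
  "prox_obj f \<sigma> xbar y - prox_obj f \<sigma> xbar x - grad (prox_obj f \<sigma> xbar) x \<bullet> (y - x)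
    \<le> (L + \<sigma>) / 2 * (norm (y - x))\<^sup>2"
proof -
  have "(L + \<sigma>) / 2 * (norm (y - x))\<^sup>2 = L / 2 * (norm (y - x))\<^sup>2 + \<sigma> / 2 * (norm (y - x))\<^sup>2"
    by (simp add: field_simps)
  then show ?thesis
    using descent[of y x] half_scaled_sqdist_expand[of \<sigma> y xbar x]
    unfolding grad_prox_obj inner_add_left inner_scaleR_left unfolding prox_obj_def by linarith
qed

text \<open>
  The strong convexity of the regularized objective, measured from its minimizer \<open>p\<close>: optimality
  makes the gradient of \<open>f\<close> at \<open>p\<close> equal to \<open>- \<sigma> (p - xbar)\<close>, and the tangent of \<open>f\<close> at \<open>p\<close>
  with this slope leaves exactly the quadratic term.
\<close>

lemma prox_obj_quadratic_growth:
  assumes "p \<in> minimizers (prox_obj f \<sigma> xbar)"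
  shows "\<sigma> / 2 * (norm (y - p))\<^sup>2 \<le> prox_obj f \<sigma> xbar y - prox_obj f \<sigma> xbar p"
proof -
  have "grad f p + \<sigma> *\<^sub>R (p - xbar) = 0"
    by (rule gradient_zero_at_minimizer[OF assms GDERIV_prox_obj[OF GDERIV_f]])
  then have g: "grad f p = - (\<sigma> *\<^sub>R (p - xbar))"
    by (simp add: eq_neg_iff_add_eq_0)
  then show ?thesis
    using above_tangent[of p y] half_scaled_sqdist_expand[of \<sigma> y xbar p]
    unfolding prox_obj_def g inner_minus_left inner_scaleR_left by linarith
qed

text \<open>
  Where the regularized objective does not exceed its value at the centre, boundedness of \<open>f\<close> from
  below confines \<open>x\<close> to a ball, on which a minimizer exists by compactness.
\<close>

lemma arg_min_prox_obj:
  assumes "minimizers f \<noteq> {}" and "\<sigma> > 0"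
  shows "arg_min (prox_obj f \<sigma> xbar) (\<lambda>_. True) \<in> minimizers (prox_obj f \<sigma> xbar)"
proof -
  let ?g = "prox_obj f \<sigma> xbar"
  obtain q where q: "f q \<le> f y" for y
    using assms(1) by (metis all_not_in_conv mem_minimizers_iff)
  define r where "r = sqrt (2 * (f xbar - f q) / \<sigma>)"
  have r: "0 \<le> r" "r\<^sup>2 = 2 * (f xbar - f q) / \<sigma>"
    using q[of xbar] assms(2) by (simp_all add: r_def)
  have "continuous_on (cball xbar r) ?g"
    unfolding prox_obj_def by (intro continuous_intros continuous_on_f)
  then obtain p where p: "p \<in> cball xbar r" "?g p \<le> ?g y" if "y \<in> cball xbar r" for y
    using continuous_attains_inf[of "cball xbar r" ?g] r(1) by auto
  have "?g p \<le> ?g y" for y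
  proof (cases "y \<in> cball xbar r")
    case True
    then show ?thesis by (rule p(2))
  next
    case False
    then have "r\<^sup>2 \<le> (norm (y - xbar))\<^sup>2"
      using r(1) by (intro power_mono) (auto simp: dist_norm norm_minus_commute)
    then have "f xbar - f q \<le> \<sigma> / 2 * (norm (y - xbar))\<^sup>2"
      using assms(2) by (simp add: r(2) field_simps)
    then have "?g xbar \<le> ?g y"
      using q[of y] by (simp add: prox_obj_def)
    moreover have "?g p \<le> ?g xbar"
      using r(1) by (intro p(2)) simp
    ultimately show ?thesis by simp
  qed
  then have "is_arg_min ?g (\<lambda>_. True) p"
    by (simp add: is_arg_min_linorder)
  then show ?thesis
    unfolding minimizers_def arg_min_def by (auto intro: someI)
qed

lemma grad_norm_le:
  assumes "p \<in> minimizers f"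
  shows "norm (grad f x) \<le> L * norm (x - p)"
  using grad_lipschitz[of x p] gradient_zero_at_minimizer[OF assms GDERIV_f] by simp

lemma closed_minimizers: "closed (minimizers f)"
proof -
  have "minimizers f = (\<Inter>y. {x. f x \<le> f y})"
    by (auto simp: mem_minimizers_iff)
  then show ?thesis
    by (auto intro!: closed_INT closed_Collect_le continuous_on_f)
qed

end


section \<open>Backtracking\<close>

text \<open>
  The trial step \<open>x'\<close> is half as long as the usual gradient step, so that the passed test leaves the
  decrease \<open>1/2 - 1/8 = 3/8\<close> of \<open>\<parallel>d\<parallel>\<^sup>2 / (M + \<sigma>)\<close>. The test therefore turns a small optimality gap
  into a small gradient, without reference to the true smoothness constant.
\<close>

lemma backtracking_test_gradient_bound:
  assumes "backtracking_test g \<sigma> x d M" and "M + \<sigma> > 0" and "\<And>y. m \<le> g y"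
  shows "3 * (norm d)\<^sup>2 \<le> 8 * (M + \<sigma>) * (g x - m)"
proof -
  define \<tau> where "\<tau> = M + \<sigma>"
  have \<tau>: "\<tau> > 0"
    using assms(2) by (simp add: \<tau>_def)
  let ?x' = "x - (1 / (2 * \<tau>)) *\<^sub>R d"
  have "g ?x' - g x - d \<bullet> (?x' - x) \<le> \<tau> / 2 * (norm (?x' - x))\<^sup>2"
    using assms(1) by (simp add: backtracking_test_def Let_def \<tau>_def)
  moreover have "d \<bullet> (?x' - x) = - ((norm d)\<^sup>2 / (2 * \<tau>))"
    by (simp add: power2_norm_eq_inner)
  moreover have "\<tau> / 2 * (norm (?x' - x))\<^sup>2 = (norm d)\<^sup>2 / (8 * \<tau>)"
  proof -
    have "(norm (?x' - x))\<^sup>2 = (norm d)\<^sup>2 / (2 * \<tau>)\<^sup>2"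
      by (simp add: power_divide abs_mult power_mult_distrib)
    also have "\<tau> / 2 * \<dots> = (norm d)\<^sup>2 / (8 * \<tau>)"
      using \<tau> by (simp add: power2_eq_square)
    finally show ?thesis .
  qed
  moreover have "(norm d)\<^sup>2 / (2 * \<tau>) - (norm d)\<^sup>2 / (8 * \<tau>) = 3 * (norm d)\<^sup>2 / (8 * \<tau>)"
    using \<tau> by (simp add: field_simps)
  ultimately have "3 * (norm d)\<^sup>2 / (8 * \<tau>) \<le> g x - m"
    using assms(3)[of ?x'] by linarith
  then show ?thesis
    unfolding \<tau>_def[symmetric] using \<tau> by (simp add: field_simps)
qed

lemma backtracking_loop_terminates:
  assumes "0 < M" and "M \<le> 2 * L" and "\<And>M. L \<le> M \<Longrightarrow> backtracking_test g \<sigma> x d M"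
  shows "\<exists>M'. backtracking_loop g \<sigma> x d M = Some (M', 0) \<and> 0 < M' \<and> M' \<le> 2 * L
    \<and> backtracking_test g \<sigma> x d M'"
proof -
  obtain n where "L / M < 2 ^ n"
    using real_arch_pow[of 2 "L / M"] by auto
  then have "L \<le> 2 ^ n * M"
    using assms(1) by (simp add: field_simps)
  then show ?thesis
    using assms(1,2)
  proof (induction n arbitrary: M)
    case 0
    then have "backtracking_test g \<sigma> x d M"
      by (intro assms(3)) simp
    with 0 show ?case
      by (subst backtracking_loop.simps) (simp add: return_def)
  next
    case (Suc n)
    show ?case
    proof (cases "backtracking_test g \<sigma> x d M")
      case True
      with Suc.prems show ?thesis
        by (subst backtracking_loop.simps) (simp add: return_def)
    next
      case False
      then have "M < L"
        using assms(3) not_le by blast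
      then have "\<exists>M'. backtracking_loop g \<sigma> x d (2 * M) = Some (M', 0) \<and> 0 < M' \<and> M' \<le> 2 * L
          \<and> backtracking_test g \<sigma> x d M'"
        using Suc.prems by (intro Suc.IH) (simp_all add: mult_ac)
      with False show ?thesis
        by (subst backtracking_loop.simps) simp
    qed
  qed
qed

context smooth_convex
begin

lemma backtracking_prox_obj:
  assumes "0 < M" and "M \<le> 2 * L"
  shows "\<exists>M'. backtracking (prox_obj f \<sigma> xbar) \<sigma> x M = Some (M', 1) \<and> 0 < M' \<and> M' \<le> 2 * L
    \<and> backtracking_test (prox_obj f \<sigma> xbar) \<sigma> x (grad (prox_obj f \<sigma> xbar) x) M'"
proof -
  let ?g = "prox_obj f \<sigma> xbar"
  have "backtracking_test ?g \<sigma> x (grad ?g x) M" if "L \<le> M" for M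
  proof -
    have "(L + \<sigma>) / 2 * (norm v)\<^sup>2 \<le> (M + \<sigma>) / 2 * (norm v)\<^sup>2" for v :: 'a
      using that by (intro mult_right_mono) auto
    then show ?thesis
      unfolding backtracking_test_def Let_def by (rule order_trans[OF prox_obj_descent])
  qed
  from backtracking_loop_terminates[OF assms this] show ?thesis
    by (auto simp: backtracking_def eval_grad_def bind_counted_def)
qed

end


section \<open>The proximal subproblems\<close>

lemma run_subroutine_from_eq:
  assumes "k \<le> K" and "real K \<ge> 8 * sqrt (2 * snd (A f \<sigma> xbar x' K) / \<sigma>)"
    and "\<And>j. k \<le> j \<Longrightarrow> j < K \<Longrightarrow> real j < 8 * sqrt (2 * snd (A f \<sigma> xbar x' j) / \<sigma>)"
  shows "run_subroutine_from k A f \<sigma> xbar x' = Some (fst (A f \<sigma> xbar x' K), K)"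
  using assms(1,3)
proof (induction rule: inc_induct)
  case base
  then show ?case
    using assms(2) by (subst run_subroutine_from.simps) (simp add: case_prod_unfold Let_def)
next
  case (step k)
  then have "real k < 8 * sqrt (2 * snd (A f \<sigma> xbar x' k) / \<sigma>)"
    by auto
  moreover have "run_subroutine_from (k + 1) A f \<sigma> xbar x' = Some (fst (A f \<sigma> xbar x' K), K)"
    using step by auto
  ultimately show ?case
    by (subst run_subroutine_from.simps) (simp add: case_prod_unfold Let_def)
qed

text \<open>
  Every evaluation that does not stop the subroutine has an index below \<open>8 \<surd>(2 B / \<sigma>)\<close>, so the
  stopping index exceeds this number by at most one.
\<close>

lemma run_subroutine_terminates:
  assumes "\<sigma> > 0" and "B \<ge> 0" and "\<And>k. k \<ge> 1 \<Longrightarrow> snd (A f \<sigma> xbar x' k) \<le> B"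
  shows "\<exists>x l k. run_subroutine A f \<sigma> xbar x' = Some (x, k) \<and> A f \<sigma> xbar x' k = (x, l)
    \<and> 1 \<le> k \<and> 8 * sqrt (2 * l / \<sigma>) \<le> real k \<and> real k \<le> 1 + 8 * sqrt (2 * B / \<sigma>)"
proof -
  let ?l = "\<lambda>k. snd (A f \<sigma> xbar x' k)"
  define stop where "stop k \<longleftrightarrow> 1 \<le> k \<and> 8 * sqrt (2 * ?l k / \<sigma>) \<le> real k" for k
  have l_le: "8 * sqrt (2 * ?l k / \<sigma>) \<le> 8 * sqrt (2 * B / \<sigma>)" if "k \<ge> 1" for k
    using assms(1) assms(3)[OF that] by (simp add: divide_right_mono)
  have "stop (nat \<lceil>8 * sqrt (2 * B / \<sigma>)\<rceil> + 1)"
  proof -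
    have "8 * sqrt (2 * B / \<sigma>) \<le> real (nat \<lceil>8 * sqrt (2 * B / \<sigma>)\<rceil> + 1)"
      by linarith
    with l_le[of "nat \<lceil>8 * sqrt (2 * B / \<sigma>)\<rceil> + 1"] show ?thesis
      unfolding stop_def by linarith
  qed
  then have K: "stop (LEAST k. stop k)" and least: "\<And>j. stop j \<Longrightarrow> (LEAST k. stop k) \<le> j"
    by (auto intro: LeastI Least_le)
  define K where "K = (LEAST k. stop k)"
  have "run_subroutine_from 1 A f \<sigma> xbar x' = Some (fst (A f \<sigma> xbar x' K), K)"
  proof (rule run_subroutine_from_eq)
    fix j
    assume "1 \<le> j" "j < K"
    then show "real j < 8 * sqrt (2 * ?l j / \<sigma>)"
      using least[of j] unfolding K_def stop_def by (meson not_le)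
  qed (use K in \<open>auto simp: K_def stop_def\<close>)
  moreover have "real K \<le> 1 + 8 * sqrt (2 * B / \<sigma>)"
  proof (cases "K = 1")
    case True
    then show ?thesis
      using assms(1,2) by simp
  next
    case False
    then have "1 \<le> K - 1" "K - 1 < K"
      using K unfolding K_def stop_def by auto
    then have "real (K - 1) < 8 * sqrt (2 * ?l (K - 1) / \<sigma>)"
      using least[of "K - 1"] unfolding K_def stop_def by (meson not_le)
    with l_le[OF \<open>1 \<le> K - 1\<close>] show ?thesis
      by linarith
  qed
  ultimately show ?thesis
    using K[folded K_def] unfolding run_subroutine_def stop_def
    by (intro exI[of _ "fst (A f \<sigma> xbar x' K)"] exI[of _ "?l K"] exI[of _ K]) simp
qed

text \<open>
  No optimality gap is negative, so the accuracy bound of a run that starts away from the minimizer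
  has a nonnegative estimate \<open>l \<le> c L\<close>.
\<close>

lemma (in smooth_convex) subroutine_constant_nonneg:
  fixes a b :: 'a
  assumes "subroutine_accuracy A c f L" and "minimizers f \<noteq> {}" and "L > 0" and "a \<noteq> b"
  shows "c \<ge> 0"
proof -
  let ?g = "prox_obj f 1 0"
  define p where "p = arg_min ?g (\<lambda>_. True)"
  have p: "p \<in> minimizers ?g"
    unfolding p_def by (rule arg_min_prox_obj[OF assms(2)]) simp
  obtain q where q: "q \<noteq> p"
    using assms(4) by metis
  obtain x l where "A f 1 0 q 1 = (x, l)"
    by fastforce
  then have "l \<le> c * L" "?g x - ?g p \<le> l * (norm (q - p))\<^sup>2"
    using assms(1)[unfolded subroutine_accuracy_def, rule_format, of 1 1 0 q]
    by (simp_all add: Let_def p_def)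
  moreover have "?g x - ?g p \<ge> 0"
    using p by (simp add: mem_minimizers_iff)
  ultimately have "0 \<le> l * (norm (q - p))\<^sup>2" "l \<le> c * L"
    by linarith+
  then have "0 \<le> c * L"
    using q zero_le_mult_iff[of l "(norm (q - p))\<^sup>2"] by auto
  with assms(3) show ?thesis
    by (simp add: zero_le_mult_iff)
qed

locale AR_problem = smooth_convex f L
  for f :: "'a::euclidean_space \<Rightarrow> real" and L :: real +
  fixes A :: "'a subroutine" and c :: real
  assumes minimizers_nonempty: "minimizers f \<noteq> {}"
    and accuracy: "subroutine_accuracy A c f L"
    and L_pos: "L > 0" and c_nonneg: "c \<ge> 0"
begin

text \<open>The stopping rule of the subroutine says \<open>l / k\<^sup>2 \<le> \<sigma> / 128\<close>.\<close>

lemma run_subroutine_accuracy: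
  assumes "\<sigma> > 0"
  shows "\<exists>x k p. run_subroutine A f \<sigma> xbar x' = Some (x, k)
    \<and> real k \<le> 1 + 8 * sqrt (2 * c * L / \<sigma>) \<and> p \<in> minimizers (prox_obj f \<sigma> xbar)
    \<and> prox_obj f \<sigma> xbar x - prox_obj f \<sigma> xbar p \<le> \<sigma> / 128 * (norm (x' - p))\<^sup>2"
proof -
  let ?g = "prox_obj f \<sigma> xbar"
  define p where "p = arg_min ?g (\<lambda>_. True)"
  have p: "p \<in> minimizers ?g"
    unfolding p_def by (rule arg_min_prox_obj[OF minimizers_nonempty assms])
  have acc: "l \<le> c * L" "?g x - ?g p \<le> l / (real k)\<^sup>2 * (norm (x' - p))\<^sup>2"
    if "A f \<sigma> xbar x' k = (x, l)" "k \<ge> 1" for x l k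
    using accuracy[unfolded subroutine_accuracy_def, rule_format, of k \<sigma> xbar x'] assms that
    by (simp_all add: Let_def p_def)
  have "snd (A f \<sigma> xbar x' k) \<le> c * L" if "k \<ge> 1" for k
    using acc(1)[of k "fst (A f \<sigma> xbar x' k)"] that by simp
  moreover have "c * L \<ge> 0"
    using L_pos c_nonneg by simp
  ultimately obtain x l k where run: "run_subroutine A f \<sigma> xbar x' = Some (x, k)"
    and A: "A f \<sigma> xbar x' k = (x, l)" and k: "1 \<le> k" "8 * sqrt (2 * l / \<sigma>) \<le> real k"
      "real k \<le> 1 + 8 * sqrt (2 * (c * L) / \<sigma>)"
    using run_subroutine_terminates[OF assms, of "c * L" A f xbar x'] by blast
  have "l / (real k)\<^sup>2 \<le> \<sigma> / 128"
  proof (cases "l \<ge> 0")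
    case True
    have "(8 * sqrt (2 * l / \<sigma>))\<^sup>2 \<le> (real k)\<^sup>2"
      using k(2) True assms by (intro power_mono) auto
    then have "128 * l \<le> \<sigma> * (real k)\<^sup>2"
      using True assms by (simp add: power_mult_distrib field_simps)
    then show ?thesis
      using k(1) by (simp add: field_simps)
  next
    case False
    then have "l / (real k)\<^sup>2 \<le> 0"
      by (simp add: divide_le_0_iff)
    with assms show ?thesis by linarith
  qed
  then have "l / (real k)\<^sup>2 * (norm (x' - p))\<^sup>2 \<le> \<sigma> / 128 * (norm (x' - p))\<^sup>2"
    by (rule mult_right_mono) simp
  with acc(2)[OF A k(1)] have "?g x - ?g p \<le> \<sigma> / 128 * (norm (x' - p))\<^sup>2"
    by linarith
  with run k(3) p show ?thesis
    by (metis mult.assoc)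
qed


section \<open>The accumulative regularization method\<close>

text \<open>
  One pass of the method. The new subproblem has its minimizer \<open>p\<close> no farther from \<open>x'\<close> than the
  old one, and strong convexity brings \<open>x\<close> within an eighth of that distance from \<open>p\<close>. Since
  \<open>\<sigma> (x - xbar) = \<sigma>' (x' - xbar') + \<sigma> (x - x')\<close>, the accumulated force of the regularization terms
  grows by \<open>\<sigma> \<parallel>x - x'\<parallel> \<le> 9/8 \<sigma> \<delta>\<close>. When the returned estimate \<open>M\<close> does not exceed \<open>\<sigma>\<close>, the
  backtracking test bounds the gradient of the subproblem, and the gradient of \<open>f\<close> differs from it
  by this force.
\<close>

lemma AR_step:
  assumes \<sigma>: "0 \<le> \<sigma>'" "\<sigma>' < \<sigma>"
    and xbar: "xbar = (\<sigma>' / \<sigma>) *\<^sub>R xbar' + (1 - \<sigma>' / \<sigma>) *\<^sub>R x'"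
    and M': "0 < M'" "M' \<le> 2 * L"
    and p': "p' \<in> minimizers (prox_obj f \<sigma>' xbar')"
    and \<delta>: "norm (x' - p') \<le> \<delta>" and \<alpha>: "\<sigma>' * norm (x' - xbar') \<le> \<alpha>"
  shows "\<exists>x k p M. run_subroutine A f \<sigma> xbar x' = Some (x, k)
    \<and> real k \<le> 1 + 8 * sqrt (2 * c * L / \<sigma>)
    \<and> backtracking (prox_obj f \<sigma> xbar) \<sigma> x (M' / 2) = Some (M, 1) \<and> 0 < M \<and> M \<le> 2 * L
    \<and> p \<in> minimizers (prox_obj f \<sigma> xbar) \<and> norm (x - p) \<le> \<delta> / 8
    \<and> \<sigma> * norm (x - xbar) \<le> \<alpha> + 9 / 8 * \<sigma> * \<delta>
    \<and> (M \<le> \<sigma> \<longrightarrow> norm (grad f x) \<le> \<alpha> + 9 / 4 * \<sigma> * \<delta>)"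
proof -
  have \<sigma>_pos: "\<sigma> > 0"
    using \<sigma> by simp
  have center: "\<sigma> *\<^sub>R xbar = \<sigma>' *\<^sub>R xbar' + (\<sigma> - \<sigma>') *\<^sub>R x'"
    using \<sigma>_pos unfolding xbar by (simp add: scaleR_add_right right_diff_distrib)
  have \<delta>_nonneg: "\<delta> \<ge> 0"
    using \<delta> norm_ge_zero order_trans by blast
  let ?g = "prox_obj f \<sigma> xbar"
  obtain x k p where run: "run_subroutine A f \<sigma> xbar x' = Some (x, k)"
      "real k \<le> 1 + 8 * sqrt (2 * c * L / \<sigma>)"
    and p: "p \<in> minimizers ?g" and gap: "?g x - ?g p \<le> \<sigma> / 128 * (norm (x' - p))\<^sup>2"
    using run_subroutine_accuracy[OF \<sigma>_pos] by blast
  have "M' / 2 \<le> 2 * L" "0 < M' / 2"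
    using M' by simp_all
  then obtain M where M: "backtracking ?g \<sigma> x (M' / 2) = Some (M, 1)" "0 < M" "M \<le> 2 * L"
    and test: "backtracking_test ?g \<sigma> x (grad ?g x) M"
    using backtracking_prox_obj by blast
  have near: "norm (x' - p) \<le> \<delta>"
    using accumulated_minimizer_closer[OF center \<sigma>(2) p' p] \<delta> by simp
  then have "(norm (x' - p))\<^sup>2 \<le> \<delta>\<^sup>2"
    by (intro power_mono) simp_all
  then have gap': "?g x - ?g p \<le> \<sigma> / 128 * \<delta>\<^sup>2"
    by (intro order_trans[OF gap] mult_left_mono) (use \<sigma>_pos in simp_all)
  have xp: "norm (x - p) \<le> \<delta> / 8"
  proof -
    have "\<sigma> / 2 * (norm (x - p))\<^sup>2 \<le> \<sigma> / 128 * \<delta>\<^sup>2"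
      using prox_obj_quadratic_growth[OF p, of x] gap' by linarith
    then have "(norm (x - p))\<^sup>2 \<le> (\<delta> / 8)\<^sup>2"
      using \<sigma>_pos by (simp add: power_divide field_simps)
    then show ?thesis
      using \<delta>_nonneg by (simp add: power2_le_iff_abs_le)
  qed
  have force: "\<sigma> * norm (x - xbar) \<le> \<alpha> + 9 / 8 * \<sigma> * \<delta>"
  proof -
    have "norm (x - x') \<le> norm (x - p) + norm (x' - p)"
      using norm_triangle_ineq4[of "x - p" "x' - p"] by simp
    then have "\<sigma> * norm (x - x') \<le> \<sigma> * (9 / 8 * \<delta>)"
      using near xp \<sigma>_pos by (intro mult_left_mono) auto
    moreover have "\<sigma> *\<^sub>R (x - xbar) = \<sigma>' *\<^sub>R (x' - xbar') + \<sigma> *\<^sub>R (x - x')"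
      using center by (simp add: algebra_simps)
    then have "norm (\<sigma> *\<^sub>R (x - xbar)) \<le> norm (\<sigma>' *\<^sub>R (x' - xbar')) + norm (\<sigma> *\<^sub>R (x - x'))"
      by (metis norm_triangle_ineq)
    then have "\<sigma> * norm (x - xbar) \<le> \<sigma>' * norm (x' - xbar') + \<sigma> * norm (x - x')"
      using \<sigma> \<sigma>_pos by simp
    ultimately show ?thesis
      using \<alpha> by linarith
  qed
  have "norm (grad f x) \<le> \<alpha> + 9 / 4 * \<sigma> * \<delta>" if "M \<le> \<sigma>"
  proof -
    have "3 * (norm (grad ?g x))\<^sup>2 \<le> 8 * (M + \<sigma>) * (?g x - ?g p)"
      by (rule backtracking_test_gradient_bound[OF test])
        (use p M(2) \<sigma>_pos in \<open>auto simp: mem_minimizers_iff\<close>)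
    also have "\<dots> \<le> (16 * \<sigma>) * (\<sigma> / 128 * \<delta>\<^sup>2)"
      using p by (intro mult_mono[OF _ gap']) (use that \<sigma>_pos in \<open>simp_all add: mem_minimizers_iff\<close>)
    finally have "24 * (norm (grad ?g x))\<^sup>2 \<le> (\<sigma> * \<delta>)\<^sup>2"
      by (simp add: power2_eq_square mult_ac)
    then have "(norm (grad ?g x))\<^sup>2 \<le> (\<sigma> * \<delta>)\<^sup>2"
      using zero_le_power2[of "norm (grad ?g x)"] by linarith
    then have "norm (grad ?g x) \<le> \<sigma> * \<delta>"
      using \<sigma>_pos \<delta>_nonneg by (simp add: power2_le_iff_abs_le)
    moreover have "norm (grad f x) \<le> norm (grad ?g x) + \<sigma> * norm (x - xbar)"
      using norm_triangle_ineq4[of "grad ?g x" "\<sigma> *\<^sub>R (x - xbar)"] \<sigma>_pos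
      by (simp add: grad_prox_obj)
    moreover have "\<sigma> * \<delta> \<ge> 0"
      using \<sigma>_pos \<delta>_nonneg by simp
    ultimately show ?thesis
      using force by linarith
  qed
  with run p M xp force show ?thesis
    by blast
qed

text \<open>
  A bound on the evaluations from the pass with weight \<open>\<sigma>\<close> on. The last summand is the geometric
  series of the terms \<open>8 \<surd>(2 c L / \<sigma>)\<close>, and the other one counts two evaluations per pass. Without
  the case split it would not be inductive: the step needs \<open>\<surd>(2 L / \<sigma>) \<ge> 2\<close>, but before the last
  pass only \<open>\<surd>(2 L / \<sigma>) > 1\<close> is certain.
\<close>

definition AR_cost :: "real \<Rightarrow> real" where
  "AR_cost \<sigma> = (if 2 * L \<le> \<sigma> then 2 else 2 + 2 * sqrt (2 * L / \<sigma>)) + 16 * sqrt (2 * c * L / \<sigma>)"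

lemma AR_cost_step:
  assumes "0 < \<sigma>"
  shows "2 + 8 * sqrt (2 * c * L / \<sigma>) \<le> AR_cost \<sigma>"
    and "\<sigma> < 2 * L \<Longrightarrow> 2 + 8 * sqrt (2 * c * L / \<sigma>) + AR_cost (4 * \<sigma>) \<le> AR_cost \<sigma>"
proof -
  have s: "sqrt (2 * c * L / \<sigma>) \<ge> 0" "sqrt (2 * L / \<sigma>) \<ge> 0"
    using assms L_pos c_nonneg by simp_all
  then show "2 + 8 * sqrt (2 * c * L / \<sigma>) \<le> AR_cost \<sigma>"
    by (simp add: AR_cost_def)
  assume less: "\<sigma> < 2 * L"
  have half: "sqrt (2 * c * L / (4 * \<sigma>)) = sqrt (2 * c * L / \<sigma>) / 2"
    "sqrt (2 * L / (4 * \<sigma>)) = sqrt (2 * L / \<sigma>) / 2"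
    using real_sqrt_divide[of "2 * c * L / \<sigma>" 4] real_sqrt_divide[of "2 * L / \<sigma>" 4]
    by (simp_all add: mult_ac)
  have one: "1 \<le> sqrt (2 * L / \<sigma>)"
    using less assms by simp
  have two: "2 \<le> sqrt (2 * L / \<sigma>)" if "4 * \<sigma> < 2 * L"
    using that assms by (intro real_le_rsqrt) (simp add: field_simps)
  show "2 + 8 * sqrt (2 * c * L / \<sigma>) + AR_cost (4 * \<sigma>) \<le> AR_cost \<sigma>"
    using less one two unfolding AR_cost_def half by auto
qed

text \<open>
  The induction is on the number \<open>m\<close> of further quadruplings after which \<open>\<sigma> \<ge> 2 L\<close>, when every
  estimate returned by backtracking makes the method stop.
\<close>

lemma AR_loop_correct:
  assumes "2 * L \<le> 4 ^ m * \<sigma>" and "0 \<le> \<sigma>'" "\<sigma>' < \<sigma>" and "0 < M'" "M' \<le> 2 * L"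
    and "p' \<in> minimizers (prox_obj f \<sigma>' xbar')"
    and "norm (x' - p') \<le> \<delta>" and "\<sigma>' * norm (x' - xbar') \<le> \<alpha>"
  shows "\<exists>x M N. AR_loop A f \<sigma>' \<sigma> xbar' x' M' = Some ((x, M), N) \<and> 0 < M \<and> M \<le> 2 * L
    \<and> norm (grad f x) \<le> \<alpha> + 9 / 4 * \<sigma> * \<delta> \<and> real N \<le> AR_cost \<sigma>"
  using assms
proof (induction m arbitrary: \<sigma> \<sigma>' xbar' x' M' p' \<delta> \<alpha>)
  case (0 \<sigma> \<sigma>' xbar' x' M' p' \<delta> \<alpha>)
  let ?xbar = "(\<sigma>' / \<sigma>) *\<^sub>R xbar' + (1 - \<sigma>' / \<sigma>) *\<^sub>R x'"
  obtain x k p M where step: "run_subroutine A f \<sigma> ?xbar x' = Some (x, k)"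
      "real k \<le> 1 + 8 * sqrt (2 * c * L / \<sigma>)"
      "backtracking (prox_obj f \<sigma> ?xbar) \<sigma> x (M' / 2) = Some (M, 1)" "0 < M" "M \<le> 2 * L"
      "M \<le> \<sigma> \<longrightarrow> norm (grad f x) \<le> \<alpha> + 9 / 4 * \<sigma> * \<delta>"
    using AR_step[OF "0.prems"(2,3) refl "0.prems"(4-8)] by blast
  have "M \<le> \<sigma>"
    using step(5) "0.prems"(1) by simp
  then have "AR_loop A f \<sigma>' \<sigma> xbar' x' M' = Some ((x, M), k + 1)"
    using step by (subst AR_loop.simps) (simp add: bind_counted_def return_def Let_def)
  moreover have "real (k + 1) \<le> AR_cost \<sigma>"
    using AR_cost_step(1)[of \<sigma>] "0.prems"(2,3) step(2) by simp
  ultimately show ?case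
    using step \<open>M \<le> \<sigma>\<close> by blast
next
  case (Suc m \<sigma> \<sigma>' xbar' x' M' p' \<delta> \<alpha>)
  let ?xbar = "(\<sigma>' / \<sigma>) *\<^sub>R xbar' + (1 - \<sigma>' / \<sigma>) *\<^sub>R x'"
  obtain x k p M where step: "run_subroutine A f \<sigma> ?xbar x' = Some (x, k)"
      "real k \<le> 1 + 8 * sqrt (2 * c * L / \<sigma>)"
      "backtracking (prox_obj f \<sigma> ?xbar) \<sigma> x (M' / 2) = Some (M, 1)" "0 < M" "M \<le> 2 * L"
      "p \<in> minimizers (prox_obj f \<sigma> ?xbar)" "norm (x - p) \<le> \<delta> / 8"
      "\<sigma> * norm (x - ?xbar) \<le> \<alpha> + 9 / 8 * \<sigma> * \<delta>"
      "M \<le> \<sigma> \<longrightarrow> norm (grad f x) \<le> \<alpha> + 9 / 4 * \<sigma> * \<delta>"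
    using AR_step[OF Suc.prems(2,3) refl Suc.prems(4-8)] by blast
  have \<sigma>_pos: "\<sigma> > 0"
    using Suc.prems(2,3) by simp
  show ?case
  proof (cases "M \<le> \<sigma>")
    case True
    then have "AR_loop A f \<sigma>' \<sigma> xbar' x' M' = Some ((x, M), k + 1)"
      using step by (subst AR_loop.simps) (simp add: bind_counted_def return_def Let_def)
    moreover have "real (k + 1) \<le> AR_cost \<sigma>"
      using AR_cost_step(1)[OF \<sigma>_pos] step(2) by simp
    ultimately show ?thesis
      using step True by blast
  next
    case False
    \<comment> \<open>The distance shrinks by 8 while the weight grows by 4, so the remaining passes add only half
      of the allowance of this one: \<open>9/8 + 9/4 / 2 = 9/4\<close>.\<close>
    have "\<exists>y M'' N. AR_loop A f \<sigma> (4 * \<sigma>) ?xbar x M = Some ((y, M''), N) \<and> 0 < M'' \<and> M'' \<le> 2 * L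
        \<and> norm (grad f y) \<le> (\<alpha> + 9 / 8 * \<sigma> * \<delta>) + 9 / 4 * (4 * \<sigma>) * (\<delta> / 8)
        \<and> real N \<le> AR_cost (4 * \<sigma>)"
      using Suc.prems(1) \<sigma>_pos step by (intro Suc.IH) (simp_all add: mult_ac)
    then obtain y M'' N where rest: "AR_loop A f \<sigma> (4 * \<sigma>) ?xbar x M = Some ((y, M''), N)"
        "0 < M''" "M'' \<le> 2 * L"
        "norm (grad f y) \<le> (\<alpha> + 9 / 8 * \<sigma> * \<delta>) + 9 / 4 * (4 * \<sigma>) * (\<delta> / 8)"
        "real N \<le> AR_cost (4 * \<sigma>)"
      by blast
    have "AR_loop A f \<sigma>' \<sigma> xbar' x' M' = Some ((y, M''), k + (1 + N))"
      using step rest(1) False by (subst AR_loop.simps) (simp add: bind_counted_def return_def Let_def)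
    moreover have "norm (grad f y) \<le> \<alpha> + 9 / 4 * \<sigma> * \<delta>"
      using rest(4) by (simp add: algebra_simps)
    moreover have "real (k + (1 + N)) \<le> AR_cost \<sigma>"
      using AR_cost_step(2)[OF \<sigma>_pos] False step(2,5) rest(5) by simp
    ultimately show ?thesis
      using rest by blast
  qed
qed

theorem AR_correct:
  assumes "0 < \<sigma>" and "0 < M'" "M' \<le> 2 * L" and "p \<in> minimizers f"
  shows "\<exists>x M N. AR A f x\<^sub>0 \<sigma> M' = Some ((x, M), N) \<and> 0 < M \<and> M \<le> 2 * L
    \<and> norm (grad f x) \<le> 9 / 4 * \<sigma> * norm (x\<^sub>0 - p)
    \<and> real N \<le> 2 + (2 * sqrt 2 + 16 * sqrt (2 * c)) * sqrt (L / \<sigma>)"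
proof -
  obtain m where "2 * L / \<sigma> < 4 ^ m"
    using real_arch_pow[of 4 "2 * L / \<sigma>"] by auto
  then have m: "2 * L \<le> 4 ^ m * \<sigma>"
    using assms(1) by (simp add: field_simps)
  have "\<exists>x M N. AR_loop A f 0 \<sigma> x\<^sub>0 x\<^sub>0 M' = Some ((x, M), N) \<and> 0 < M \<and> M \<le> 2 * L
      \<and> norm (grad f x) \<le> 0 + 9 / 4 * \<sigma> * norm (x\<^sub>0 - p) \<and> real N \<le> AR_cost \<sigma>"
    by (rule AR_loop_correct[OF m, where p' = p]) (use assms in simp_all)
  moreover have "AR_cost \<sigma> \<le> 2 + (2 * sqrt 2 + 16 * sqrt (2 * c)) * sqrt (L / \<sigma>)"
  proof -
    have "sqrt (2 * L / \<sigma>) = sqrt 2 * sqrt (L / \<sigma>)" "sqrt (2 * c * L / \<sigma>) = sqrt (2 * c) * sqrt (L / \<sigma>)"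
      by (simp_all add: real_sqrt_mult real_sqrt_divide)
    then show ?thesis
      using L_pos assms(1) by (simp add: AR_cost_def algebra_simps)
  qed
  ultimately show ?thesis
    unfolding AR_def by fastforce
qed


section \<open>Guessing the distance to the minimizers\<close>

text \<open>
  The run of the method with guess \<open>D\<close> costs a constant plus a multiple of \<open>\<surd>D\<close>. The guesses are
  quadrupled, so these square roots form a geometric series of ratio 2, and a guess is rejected only
  if it is below \<open>d\<close>, so the last one is below \<open>4 d\<close>. The term \<open>- 2 \<surd>D'\<close> makes the bound on the
  series inductive.
\<close>

lemma guess_and_check_loop_correct:
  assumes \<epsilon>: "\<epsilon> > 0" and p: "p \<in> minimizers f" "norm (x\<^sub>0 - p) \<le> d"
    and "d \<le> 4 ^ n * D'" and "0 < D'" "D' < d" and "0 < M" "M \<le> 2 * L"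
  shows "\<exists>xhat N. guess_and_check_loop A f \<epsilon> x\<^sub>0 D' M = Some (xhat, N) \<and> norm (grad f xhat) \<le> \<epsilon>
    \<and> real N \<le> 3 * real n
      + (2 * sqrt 2 + 16 * sqrt (2 * c)) * sqrt (5 * L / \<epsilon>) * (4 * sqrt d - 2 * sqrt D')"
  using assms(4-)
proof (induction n arbitrary: D' M)
  case 0
  then show ?case by simp
next
  case (Suc n)
  define K where "K = (2 * sqrt 2 + 16 * sqrt (2 * c)) * sqrt (5 * L / \<epsilon>)"
  have K: "K \<ge> 0"
    using c_nonneg L_pos \<epsilon> by (simp add: K_def)
  let ?D = "4 * D'"
  let ?\<sigma> = "\<epsilon> / (5 * ?D)"
  have \<sigma>: "0 < ?\<sigma>"
    using \<epsilon> Suc.prems(2) by simp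
  obtain x M' N where AR: "AR A f x\<^sub>0 ?\<sigma> M = Some ((x, M'), N)" "0 < M'" "M' \<le> 2 * L"
      "norm (grad f x) \<le> 9 / 4 * ?\<sigma> * norm (x\<^sub>0 - p)"
      "real N \<le> 2 + (2 * sqrt 2 + 16 * sqrt (2 * c)) * sqrt (L / ?\<sigma>)"
    using AR_correct[OF \<sigma> Suc.prems(4,5) p(1)] by blast
  have sqrtD: "sqrt ?D = 2 * sqrt D'"
    by (simp add: real_sqrt_mult)
  have "sqrt (L / ?\<sigma>) = sqrt (5 * L / \<epsilon> * ?D)"
    by (simp add: mult_ac)
  also have "\<dots> = sqrt (5 * L / \<epsilon>) * (2 * sqrt D')"
    by (simp only: real_sqrt_mult[of "5 * L / \<epsilon>"] sqrtD)
  finally have N: "real N \<le> 2 + K * (2 * sqrt D')"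
    using AR(5) by (simp add: K_def mult_ac)
  show ?case
  proof (cases "norm (grad f x) \<le> \<epsilon>")
    case True
    then have "guess_and_check_loop A f \<epsilon> x\<^sub>0 D' M = Some (x, N + 1)"
      using AR(1) by (subst guess_and_check_loop.simps)
        (simp add: bind_counted_def return_def eval_grad_def Let_def)
    moreover have "K * (2 * sqrt D') \<le> K * (4 * sqrt d - 2 * sqrt D')"
    proof (rule mult_left_mono[OF _ K])
      have "sqrt D' \<le> sqrt d"
        using Suc.prems(3) by simp
      then show "2 * sqrt D' \<le> 4 * sqrt d - 2 * sqrt D'"
        by linarith
    qed
    then have "real (N + 1) \<le> 3 * real (Suc n) + K * (4 * sqrt d - 2 * sqrt D')"
      using N by simp
    ultimately show ?thesis
      using True unfolding K_def by blast
  next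
    case False
    have "?D < d"
    proof (rule ccontr)
      assume "\<not> ?D < d"
      then have "norm (x\<^sub>0 - p) \<le> ?D"
        using p(2) by simp
      then have "9 / 4 * ?\<sigma> * norm (x\<^sub>0 - p) \<le> 9 / 4 * ?\<sigma> * ?D"
        using \<sigma> by (intro mult_left_mono) simp_all
      also have "\<dots> = 9 / 20 * \<epsilon>"
        using Suc.prems(2) by simp
      finally show False
        using AR(4) False \<epsilon> by simp
    qed
    moreover have "d \<le> 4 ^ n * ?D" "0 < ?D"
      using Suc.prems(1,2) by (simp_all add: mult_ac)
    ultimately obtain xhat N' where rest: "guess_and_check_loop A f \<epsilon> x\<^sub>0 ?D M' = Some (xhat, N')"
        "norm (grad f xhat) \<le> \<epsilon>" "real N' \<le> 3 * real n + K * (4 * sqrt d - 2 * sqrt ?D)"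
      using Suc.IH[of ?D M'] AR(2,3) unfolding K_def by blast
    have "guess_and_check_loop A f \<epsilon> x\<^sub>0 D' M = Some (xhat, N + (1 + N'))"
      using AR(1) rest(1) False by (subst guess_and_check_loop.simps)
        (simp add: bind_counted_def return_def eval_grad_def Let_def)
    moreover have "real (N + (1 + N')) \<le> 3 * real (Suc n) + K * (4 * sqrt d - 2 * sqrt D')"
      using N rest(3) unfolding sqrtD by (simp add: algebra_simps)
    ultimately show ?thesis
      using rest(2) unfolding K_def by blast
  qed
qed

end


section \<open>The complete algorithm\<close>

theorem theorem4p2:
  fixes f :: "real ^ 'n \<Rightarrow> real" and A :: "(real ^ 'n) subroutine"
    and L \<epsilon> c\<^sub>A :: real and x\<^sub>0 :: "real ^ 'n"
  assumes "convex_on UNIV f"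
    and "smooth L f"
    and "minimizers f \<noteq> {}"
    and "\<epsilon> > 0"
    and "norm (grad f x\<^sub>0) > \<epsilon>"
    and "subroutine_accuracy A c\<^sub>A f L"
  shows "(\<exists>z\<^sub>0. admissible_start f x\<^sub>0 z\<^sub>0) \<and>
    (\<forall>z\<^sub>0. admissible_start f x\<^sub>0 z\<^sub>0 \<longrightarrow>
      (\<exists>xhat N. guess_and_check A f \<epsilon> x\<^sub>0 z\<^sub>0 = Some (xhat, N) \<and>
        norm (grad f xhat) \<le> \<epsilon> \<and>
        (let dist\<^sub>0 = infdist x\<^sub>0 (minimizers f);
             C\<^sub>1 = sqrt 2 * (3 + 16 * sqrt (2 * c\<^sub>A))
         in real N \<le> 4 * real_of_int \<lceil>log 4 (4 * sqrt 2 * L * dist\<^sub>0 / \<epsilon>)\<rceil>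
                     + 4 * sqrt 5 * C\<^sub>1 * sqrt (L * dist\<^sub>0 / \<epsilon>))))"
proof -
  interpret smooth_convex f L
    using assms(1,2) by unfold_locales
  let ?d = "infdist x\<^sub>0 (minimizers f)"
  let ?g = "norm (grad f x\<^sub>0)"
  obtain p where p: "p \<in> minimizers f" and d: "?d = norm (x\<^sub>0 - p)"
    using infdist_attains_inf[OF closed_minimizers assms(3), of x\<^sub>0] by (auto simp: dist_norm)
  have grad_p: "grad f p = 0"
    by (rule gradient_zero_at_minimizer[OF p GDERIV_f])
  have g_pos: "?g > 0"
    using assms(4,5) by linarith
  have g_le: "?g \<le> L * ?d"
    using grad_norm_le[OF p, of x\<^sub>0] d by simp
  then have Ld: "\<epsilon> < L * ?d"
    using assms(5) by linarith
  then have "0 < L * ?d"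
    using assms(4) by linarith
  then have L: "L > 0" and d_pos: "?d > 0"
    using infdist_nonneg[of x\<^sub>0 "minimizers f"] by (auto simp: zero_less_mult_iff)
  have x\<^sub>0_p: "p \<noteq> x\<^sub>0" "grad f x\<^sub>0 \<noteq> grad f p"
    using d_pos d assms(4,5) grad_p by auto
  have c: "c\<^sub>A \<ge> 0"
    by (rule subroutine_constant_nonneg[OF assms(6,3) L x\<^sub>0_p(1)])
  interpret AR_problem f L A c\<^sub>A
    by unfold_locales (use assms L c in auto)

  have "\<exists>xhat N. guess_and_check A f \<epsilon> x\<^sub>0 z\<^sub>0 = Some (xhat, N) \<and> norm (grad f xhat) \<le> \<epsilon>
      \<and> real N \<le> 4 * real_of_int \<lceil>log 4 (4 * sqrt 2 * L * ?d / \<epsilon>)\<rceil>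
          + 4 * sqrt 5 * (sqrt 2 * (3 + 16 * sqrt (2 * c\<^sub>A))) * sqrt (L * ?d / \<epsilon>)"
    if "admissible_start f x\<^sub>0 z\<^sub>0" for z\<^sub>0
  proof -
    let ?M = "norm (grad f x\<^sub>0 - grad f z\<^sub>0) / norm (x\<^sub>0 - z\<^sub>0)"
    let ?l = "log 4 (4 * sqrt 2 * L * ?d / \<epsilon>)"
    have z\<^sub>0: "norm (x\<^sub>0 - z\<^sub>0) > 0" "norm (grad f x\<^sub>0 - grad f z\<^sub>0) > 0"
      using that by (auto simp: admissible_start_def)
    then have "?M \<le> L"
      using grad_lipschitz[of x\<^sub>0 z\<^sub>0] by (simp add: field_simps)
    then have "0 < ?M" "?M \<le> 2 * L"
      using z\<^sub>0 L by simp_all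
    then obtain M where M: "backtracking f 0 x\<^sub>0 ?M = Some (M, 1)" "0 < M" "M \<le> 2 * L"
      and test: "backtracking_test f 0 x\<^sub>0 (grad f x\<^sub>0) M"
      using backtracking_prox_obj[of ?M 0 0 x\<^sub>0] by auto
    define D\<^sub>0 where "D\<^sub>0 = ?g / (2 * sqrt 2 * M)"
    have D\<^sub>0_pos: "D\<^sub>0 > 0"
      unfolding D\<^sub>0_def using g_pos M(2) by simp
    \<comment> \<open>The decrease seen by the test is at most the gap \<open>f x\<^sub>0 - f p\<close>, which convexity bounds by
      \<open>?g * ?d\<close>. This puts \<open>D\<^sub>0\<close> below \<open>?d\<close>, as \<open>1 / (2 \<surd>2) < 3/8\<close>.\<close>
    have "D\<^sub>0 < ?d"
    proof -
      have "3 * ?g\<^sup>2 \<le> 8 * (M + 0) * (f x\<^sub>0 - f p)"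
        by (rule backtracking_test_gradient_bound[OF test])
          (use M(2) p in \<open>simp_all add: mem_minimizers_iff\<close>)
      also have "f x\<^sub>0 - f p \<le> grad f x\<^sub>0 \<bullet> (x\<^sub>0 - p)"
        using above_tangent[of x\<^sub>0 p] by (simp add: inner_diff_right)
      also have "\<dots> \<le> ?g * ?d"
        unfolding d by (rule norm_cauchy_schwarz)
      finally have "3 * ?g\<^sup>2 \<le> 8 * M * (?g * ?d)"
        using M(2) by simp
      then have "?g * (3 * ?g) \<le> ?g * (8 * M * ?d)"
        by (simp add: power2_eq_square mult_ac)
      then have "3 * ?g \<le> 8 * M * ?d"
        using g_pos by (rule mult_left_le_imp_le)
      moreover have "4 / 3 < sqrt 2"
        by (rule real_less_rsqrt) (simp add: power2_eq_square)
      then have "4 / 3 * (M * ?d) < sqrt 2 * (M * ?d)"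
        using M(2) d_pos by (intro mult_strict_right_mono) simp_all
      ultimately have "?g < 2 * sqrt 2 * M * ?d"
        by simp
      then show ?thesis
        using M(2) by (simp add: D\<^sub>0_def field_simps)
    qed
    define n where "n = nat \<lceil>?l\<rceil>"
    have "1 < sqrt (2 :: real)"
      by simp
    then have "1 < 4 * sqrt (2 :: real)"
      by linarith
    then have "1 * \<epsilon> < (4 * sqrt 2) * (L * ?d)"
      using Ld assms(4) by (intro mult_strict_mono) simp_all
    then have l_arg: "4 * sqrt 2 * L * ?d / \<epsilon> > 1"
      using assms(4) by (simp add: field_simps)
    then have l_pos: "?l > 0"
      by simp
    then have n: "real n = real_of_int \<lceil>?l\<rceil>"
      unfolding n_def by simp
    have "?d \<le> 4 ^ n * D\<^sub>0"
    proof -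
      have "4 * sqrt 2 * L * ?d / \<epsilon> = 4 powr ?l"
        using l_arg by simp
      also have "\<dots> \<le> 4 powr real n"
        unfolding n by (intro powr_mono le_of_int_ceiling) simp
      also have "\<dots> = 4 ^ n"
        by (simp add: powr_realpow)
      finally have "4 * sqrt 2 * L * ?d / \<epsilon> * (\<epsilon> / (4 * sqrt 2 * L)) \<le> 4 ^ n * (\<epsilon> / (4 * sqrt 2 * L))"
        using assms(4) L by (intro mult_right_mono) simp_all
      then have "?d \<le> 4 ^ n * (\<epsilon> / (4 * sqrt 2 * L))"
        using assms(4) L by simp
      also have "\<epsilon> / (4 * sqrt 2 * L) \<le> D\<^sub>0"
        unfolding D\<^sub>0_def using assms(4,5) M by (intro frac_le) simp_all
      finally show ?thesis by simp
    qed
    define K where "K = 2 * sqrt 2 + 16 * sqrt (2 * c\<^sub>A)"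
    obtain xhat N where loop: "guess_and_check_loop A f \<epsilon> x\<^sub>0 D\<^sub>0 M = Some (xhat, N)"
        "norm (grad f xhat) \<le> \<epsilon>"
        "real N \<le> 3 * real n + K * sqrt (5 * L / \<epsilon>) * (4 * sqrt ?d - 2 * sqrt D\<^sub>0)"
      using guess_and_check_loop_correct[OF assms(4) p, of x\<^sub>0 ?d n D\<^sub>0 M]
        \<open>?d \<le> 4 ^ n * D\<^sub>0\<close> D\<^sub>0_pos \<open>D\<^sub>0 < ?d\<close> M(2,3) d unfolding K_def by auto
    have "guess_and_check A f \<epsilon> x\<^sub>0 z\<^sub>0 = Some (xhat, 3 + N)"
      using M(1) loop(1) by (simp add: guess_and_check_def bind_counted_def eval_grad_def D\<^sub>0_def)
    moreover have "real (3 + N) \<le> 4 * real n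
        + 4 * sqrt 5 * (sqrt 2 * (3 + 16 * sqrt (2 * c\<^sub>A))) * sqrt (L * ?d / \<epsilon>)"
    proof -
      define S where "S = sqrt 5 * sqrt (L * ?d / \<epsilon>)"
      have sqrt_ge_1: "1 \<le> sqrt r" if "r \<ge> 1" for r :: real
        using that by simp
      have "1 * 1 \<le> S"
        unfolding S_def using Ld assms(4) by (intro mult_mono sqrt_ge_1) simp_all
      have "K \<ge> 0"
        using c by (simp add: K_def)
      have "sqrt (5 * L / \<epsilon>) * sqrt ?d = S"
        unfolding S_def real_sqrt_mult[symmetric] by (simp add: mult_ac)
      then have "K * sqrt (5 * L / \<epsilon>) * (4 * sqrt ?d) = 4 * K * S"
        by (simp add: mult_ac)
      moreover have "K * sqrt (5 * L / \<epsilon>) * (4 * sqrt ?d - 2 * sqrt D\<^sub>0)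
          \<le> K * sqrt (5 * L / \<epsilon>) * (4 * sqrt ?d)"
        using \<open>K \<ge> 0\<close> L assms(4) D\<^sub>0_pos by (intro mult_left_mono) simp_all
      ultimately have "real N \<le> 3 * real n + 4 * K * S"
        using loop(3) by linarith
      \<comment> \<open>The three initial evaluations are paid for by the difference between \<open>K\<close> and the stated
        constant, which is at least 1, and by \<open>S \<ge> 1\<close>.\<close>
      moreover have "K + 1 \<le> sqrt 2 * (3 + 16 * sqrt (2 * c\<^sub>A))"
      proof -
        have "1 * (16 * sqrt (2 * c\<^sub>A)) \<le> sqrt 2 * (16 * sqrt (2 * c\<^sub>A))"
          using c by (intro mult_right_mono sqrt_ge_1) simp_all
        then show ?thesis
          using sqrt_ge_1[of 2] unfolding K_def distrib_left by linarith
      qed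
      then have "4 * S * (K + 1) \<le> 4 * S * (sqrt 2 * (3 + 16 * sqrt (2 * c\<^sub>A)))"
        using \<open>1 * 1 \<le> S\<close> by (intro mult_left_mono) simp_all
      then have "4 * K * S + 4 * S \<le> 4 * sqrt 5 * (sqrt 2 * (3 + 16 * sqrt (2 * c\<^sub>A))) * sqrt (L * ?d / \<epsilon>)"
        unfolding S_def by (simp add: algebra_simps)
      ultimately show ?thesis
        using \<open>1 * 1 \<le> S\<close> by linarith
    qed
    ultimately show ?thesis
      using loop(2) unfolding n by blast
  qed
  moreover have "admissible_start f x\<^sub>0 p"
    using x\<^sub>0_p by (simp add: admissible_start_def)
  ultimately show ?thesis
    unfolding Let_def by blast
qed

end
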